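(* If $d$ and $n$ are nonnegative integers, $n\ge3$, then $$\sum_{j_{n-3}\ge j_{n-4}\ge\cdots\ge j_1\ge j_0=0}\frac{d!^{\,n-2}}{(d-j_{n-3})!\prod_{i=2}^{n-2}(d-j_{i-1})!\,(j_{i-1}-j_{i-2})!\,j_{i-1}!}$$ $$=\frac{(-1)^d}2\sum_{m=0}^d\binom dm^n\Big(n(d-2m)\big(\gamma(m)-\gamma(d-m)\big)+2\Big).$$
   Context: For a positive integer $m$, $\gamma(m)=\sum_{j=1}^m\frac1j$, and $\gamma(0)=0$. On the left side the sum is over integers $j_1,\dots,j_{n-3}$ with $0=j_0\le j_1\le\dots\le j_{n-3}\le d$ (terms with a factorial of a negative integer in the denominator are zero); all three factors $(d-j_{i-1})!$, $(j_{i-1}-j_{i-2})!$, $j_{i-1}!$ are inside the product over $i$. For $n=3$ there are no summation variables, the product is empty, and the only term has $j_{n-3}=j_0=0$. *)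

theory Defs
  imports "HOL-Analysis.Harmonic_Numbers" "HOL-Library.FuncSet"
begin

text \<open>The harmonic number \<open>\<gamma>(m)\<close> is the library's \<open>harm m\<close>, with \<open>harm 0 = 0\<close>.

  An index tuple \<open>0 = j\<^sub>0 \<le> j\<^sub>1 \<le> \<dots> \<le> j\<^sub>k \<le> d\<close> is encoded as a function that is
  \<open>undefined\<close> outside \<open>{0..k}\<close>, so that distinct elements are distinct tuples and the set is finite.
  For \<open>k = 0\<close> the only element is \<open>j\<^sub>0 = 0\<close>.\<close>

definition weak_chains :: "nat \<Rightarrow> nat \<Rightarrow> (nat \<Rightarrow> nat) set" where
  "weak_chains k d =
     {j \<in> {0..k} \<rightarrow>\<^sub>E {0..d}. j 0 = 0 \<and> (\<forall>i\<in>{1..k}. j (i - 1) \<le> j i)}"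

end

theory Submission imports Defs begin

text \<open>
  The idea is to replace the upper index \<open>d\<close> of the binomial coefficients by a variable \<open>D\<close>,
  where the identity becomes an instance of a Bailey chain, and then to let \<open>D\<close> tend to \<open>d\<close>.

  Put \<open>\<beta>\<^sub>0(N) = [N = 0]\<close> and
  \<open>\<beta>\<^sub>i\<^sub>+\<^sub>1(N) = (\<Sum>j\<le>N. (N choose j) * (D gchoose j) * \<beta>\<^sub>i(j))\<close>. For \<open>D = d\<close> the chain sum is
  \<open>\<beta>\<^sub>n\<^sub>-\<^sub>2(d)\<close>: summing over the last entry of a chain first is the adjoint of one step of this
  recursion (lemma \<open>sum_weak_chains_eq_bailey_beta\<close>).

  For \<open>D\<close> not an integer, \<open>\<beta>\<^sub>i(N)\<close> is a single sum with summand
  \<open>(D - 2 m) * (D gchoose m) ^ (i + 1)\<close> times a kernel \<open>k(N, m)\<close> (lemma \<open>bailey_chain\<close>). This is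
  Bailey's lemma at \<open>q = 1\<close> with parameter \<open>a = - D\<close>. The start of the chain is the unit Bailey
  pair, a telescoping sum. One step of the recursion multiplies the \<open>m\<close>-th summand by
  \<open>D gchoose m\<close>, because after cancellation the sum over \<open>j\<close> is an iterated difference of the
  reciprocal of a falling factorial.

  The kernel \<open>k(d, m)\<close> has a simple pole at \<open>D = d\<close>. Hence \<open>(D - d) * \<beta>\<^sub>n\<^sub>-\<^sub>2(d)\<close> is a sum \<open>S(D)\<close> of
  functions that are regular at \<open>d\<close>. At \<open>D = d\<close> the \<open>m\<close>-th of them is
  \<open>(-1) ^ d * (d choose m) ^ n * (d - 2 m)\<close>, which is antisymmetric under \<open>m \<mapsto> d - m\<close>, so
  \<open>S(d) = 0\<close>. Since \<open>\<beta>\<^sub>n\<^sub>-\<^sub>2(d)\<close> is a polynomial in \<open>D\<close>, its value at \<open>d\<close> is the derivative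
  \<open>S'(d)\<close>. Logarithmic derivatives of falling factorials at integers are differences of harmonic
  numbers, and the same antisymmetry brings \<open>S'(d)\<close> to the symmetric form of the theorem.
\<close>

section \<open>Falling factorials\<close>

definition falling :: "'a::comm_ring_1 \<Rightarrow> nat \<Rightarrow> 'a" where
  "falling y k = (\<Prod>t<k. y - of_nat t)"

lemma falling_0 [simp]: "falling y 0 = 1"
  by (simp add: falling_def)

lemma falling_Suc: "falling y (Suc k) = falling y k * (y - of_nat k)"
  by (simp add: falling_def)

lemma falling_add: "falling y (a + b) = falling y a * falling (y - of_nat a) b"
  by (induction b) (simp_all add: falling_Suc algebra_simps)

lemma falling_Suc_left: "falling y (Suc k) = y * falling (y - 1) k"
  using falling_add[of y 1 k] by (simp add: falling_Suc)

lemma falling_nonzero: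
  fixes y :: "'a::{field_char_0}"
  assumes "y \<notin> \<int>"
  shows "falling y k \<noteq> 0"
  using assms by (auto simp: falling_def)

lemma gbinomial_falling: "(y gchoose k) = falling y k / fact k"
  by (simp add: falling_def gbinomial_prod_rev lessThan_atLeast0)

lemma falling_of_nat_fact:
  assumes "m \<le> d"
  shows "falling (of_nat d) m = (fact m * of_nat (d choose m) :: 'a::field_char_0)"
  by (simp add: binomial_gbinomial gbinomial_falling)

lemma falling_minus_one: "falling (- 1) m = ((- 1) ^ m * fact m :: 'a::field_char_0)"
  by (induction m) (simp_all add: falling_Suc algebra_simps)

text \<open>The left side is the \<open>M\<close>-th backward difference of \<open>1 / falling y (Suc m)\<close> as a function of
  \<open>y\<close>, and a single difference lengthens the falling factorial by one factor.\<close>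

lemma alternating_sum_inverse_falling:
  fixes y :: "'a::field_char_0"
  assumes "y \<notin> \<int>"
  shows "(\<Sum>r\<le>M. (-1) ^ r * of_nat (M choose r) / falling (y - of_nat r) (Suc m))
       = (-1) ^ M * fact (M + m) / fact m / falling y (Suc (M + m))"
  using assms
proof (induction M arbitrary: y)
  case 0
  then show ?case by simp
next
  case (Suc M)
  have y1: "y - 1 \<notin> \<int>"
    using Suc.prems by (metis Ints_1 Ints_add diff_add_cancel)
  let ?g = "\<lambda>r. 1 / falling (y - of_nat r) (Suc m)"
  \<comment> \<open>Pascal's rule: the difference of order \<open>Suc M\<close> at \<open>y\<close> is the one of order \<open>M\<close> at \<open>y\<close>
    minus the one of order \<open>M\<close> at \<open>y - 1\<close>.\<close>
  have "(\<Sum>r\<le>Suc M. (-1) ^ r * of_nat (Suc M choose r) * ?g r)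
      = (\<Sum>r\<le>M. (-1) ^ r * of_nat (M choose r) * ?g r)
        - (\<Sum>r\<le>M. (-1) ^ r * of_nat (M choose r) * ?g (Suc r))"
  proof -
    have "(\<Sum>r\<le>Suc M. (-1) ^ r * of_nat (Suc M choose r) * ?g r)
        = ?g 0 + (\<Sum>r\<le>M. (-1) ^ Suc r * of_nat (M choose Suc r) * ?g (Suc r))
          - (\<Sum>r\<le>M. (-1) ^ r * of_nat (M choose r) * ?g (Suc r))"
      by (simp only: sum.atMost_Suc_shift binomial_Suc_Suc)
        (simp add: algebra_simps sum.distrib add_divide_distrib sum_negf sum_subtractf)
    also have "?g 0 + (\<Sum>r\<le>M. (-1) ^ Suc r * of_nat (M choose Suc r) * ?g (Suc r))
        = (\<Sum>r\<le>Suc M. (-1) ^ r * of_nat (M choose r) * ?g r)"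
      by (simp only: sum.atMost_Suc_shift) simp
    also have "\<dots> = (\<Sum>r\<le>M. (-1) ^ r * of_nat (M choose r) * ?g r)"
      by simp
    finally show ?thesis .
  qed
  also have "\<dots> = (-1) ^ M * fact (M + m) / fact m / falling y (Suc (M + m))
                - (-1) ^ M * fact (M + m) / fact m / falling (y - 1) (Suc (M + m))"
    using Suc.IH[OF Suc.prems] Suc.IH[OF y1] by (simp add: algebra_simps)
  also have "\<dots> = (-1) ^ Suc M * fact (Suc M + m) / fact m / falling y (Suc (Suc M + m))"
  proof -
    define P where "P = falling (y - 1) (M + m)"
    have P: "P \<noteq> 0" unfolding P_def by (rule falling_nonzero[OF y1])
    define z where "z = y - 1 - of_nat (M + m)"
    have z: "z \<noteq> 0" unfolding z_def using y1 by (metis Ints_of_nat right_minus_eq)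
    have y: "y \<noteq> 0" using Suc.prems by auto
    have e1: "falling y (Suc (M + m)) = y * P" by (simp add: falling_Suc_left P_def)
    have e2: "falling (y - 1) (Suc (M + m)) = P * z" by (simp add: falling_Suc P_def z_def)
    have e3: "falling y (Suc (Suc M + m)) = y * (P * z)"
      using e2 by (simp only: falling_Suc_left add_Suc)
    have f: "fact (Suc M + m) = (y - z) * fact (M + m)"
      by (simp add: z_def algebra_simps)
    show ?thesis unfolding e1 e2 e3 f using P z y by (simp add: field_simps)
  qed
  finally show ?case by simp
qed

section \<open>The Bailey chain for a non-integral upper index\<close>

primrec bailey_beta :: "'a::field_char_0 \<Rightarrow> nat \<Rightarrow> nat \<Rightarrow> 'a" where
  "bailey_beta D 0 = (\<lambda>N. if N = 0 then 1 else 0)"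
| "bailey_beta D (Suc i) =
     (\<lambda>N. \<Sum>j\<le>N. of_nat (N choose j) * (D gchoose j) * bailey_beta D i j)"

text \<open>Up to factors that depend on only one of \<open>N\<close> and \<open>m\<close>, this is the classical kernel
  \<open>1 / ((N - m)! * pochhammer (1 - D) (N + m))\<close> of a Bailey pair relative to \<open>a = - D\<close>. The factors
  are chosen such that the recursion for \<^const>\<open>bailey_beta\<close> multiplies the \<open>m\<close>-th term by exactly
  \<open>D gchoose m\<close>.\<close>

definition bailey_kernel :: "'a::field_char_0 \<Rightarrow> nat \<Rightarrow> nat \<Rightarrow> 'a" where
  "bailey_kernel D N m =
     (-1) ^ (N + m) * fact N * fact m * of_nat (N choose m) / falling D (Suc (N + m))"

text \<open>For \<open>N > 0\<close> the sum telescopes. Up to a constant, the summand is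
  \<open>(-1) ^ m * (N choose m) * (D - 2 m)\<close> divided by \<open>falling (D - m) (Suc N)\<close>, and Pascal's rule
  together with \<open>m * (N choose m) = N * (N - 1 choose m - 1)\<close> splits \<open>(N choose m) * (D - 2 m)\<close> into
  \<open>(N - 1 choose m - 1) * (D - m - N) + (N - 1 choose m) * (D - m)\<close>. Each part cancels one end
  factor of the denominator.\<close>

lemma unit_bailey_pair:
  fixes D :: "'a::field_char_0"
  assumes D: "D \<notin> \<int>"
  shows "(\<Sum>m\<le>N. (D - 2 * of_nat m) * (D gchoose m) * bailey_kernel D N m)
       = (if N = 0 then 1 else 0)"
proof (cases N)
  case 0
  have "D \<noteq> 0" using D by auto
  then show ?thesis using 0 by (simp add: bailey_kernel_def falling_Suc)
next
  case (Suc K)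
  \<comment> \<open>The case distinction sets \<open>K choose (-1)\<close> to \<open>0\<close>; truncated subtraction would give \<open>1\<close>.\<close>
  define G where "G m = (-1) ^ m * (if m = 0 then 0 else of_nat (K choose (m - 1)))
                         / falling (D - of_nat m) N" for m
  have shift: "D - of_nat m \<notin> \<int>" for m
    using D by (metis Ints_add Ints_of_nat diff_add_cancel)
  have term_eq: "(D - 2 * of_nat m) * (D gchoose m) * bailey_kernel D N m
      = (-1) ^ N * fact N * (G m - G (Suc m))" for m
  proof -
    define x where "x = D - of_nat m"
    define P where "P = falling (x - 1) K"
    have x: "x \<notin> \<int>" "x - 1 \<notin> \<int>"
      using shift[of m] shift[of "Suc m"] by (simp_all add: x_def algebra_simps)
    have P: "P \<noteq> 0" unfolding P_def by (rule falling_nonzero[OF x(2)])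
    have x0: "x \<noteq> 0" "x - of_nat N \<noteq> 0" using x by auto
    have Q: "falling D m \<noteq> 0" by (rule falling_nonzero[OF D])
    have e1: "falling x N = x * P" by (simp add: Suc falling_Suc_left P_def)
    have e2: "falling (D - of_nat (Suc m)) N = P * (x - of_nat N)"
      by (simp add: Suc falling_Suc P_def x_def algebra_simps)
    have e3: "falling D (Suc (N + m)) = falling D m * (x * (P * (x - of_nat N)))"
    proof -
      have "falling D (Suc (N + m)) = falling D m * falling x (Suc N)"
        using falling_add[of D m "Suc N"] by (simp add: x_def add_ac)
      also have "falling x (Suc N) = x * P * (x - of_nat N)"
        by (simp only: falling_Suc e1)
      finally show ?thesis by (simp add: mult_ac)
    qed
    define c where "c = (if m = 0 then 0 else of_nat (K choose (m - 1)) :: 'a)"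
    have pascal: "of_nat (N choose m) = c + of_nat (K choose m)"
      by (cases m) (simp_all add: Suc c_def)
    have absorb: "of_nat N * c = of_nat m * of_nat (N choose m)"
    proof (cases m)
      case (Suc l)
      have "of_nat (Suc K * (K choose l)) = (of_nat (Suc l * (Suc K choose Suc l)) :: 'a)"
        using Suc_times_binomial_eq[of K l] by (simp only: mult.commute)
      moreover have "c = of_nat (K choose l)" by (simp add: c_def Suc)
      ultimately show ?thesis
        unfolding Suc \<open>N = Suc K\<close> by (simp only: of_nat_mult)
    qed (simp add: c_def)
    have key: "c * (x - of_nat N) + of_nat (K choose m) * x
             = (D - 2 * of_nat m) * of_nat (N choose m)"
    proof -
      have "c * (x - of_nat N) + of_nat (K choose m) * x
          = (c + of_nat (K choose m)) * x - of_nat N * c"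
        by (simp add: algebra_simps)
      also have "\<dots> = of_nat (N choose m) * x - of_nat m * of_nat (N choose m)"
        by (simp only: pascal[symmetric] absorb)
      finally show ?thesis by (simp add: x_def algebra_simps)
    qed
    have "G m - G (Suc m) = (-1) ^ m * (c / (x * P) + of_nat (K choose m) / (P * (x - of_nat N)))"
      unfolding G_def e2 using e1 by (simp add: x_def[symmetric] c_def algebra_simps)
    also have "\<dots> = (-1) ^ m * (c * (x - of_nat N) + of_nat (K choose m) * x)
                    / (x * (P * (x - of_nat N)))"
      using P x0 by (simp add: field_simps)
    finally have G: "G m - G (Suc m) = (-1) ^ m * ((D - 2 * of_nat m) * of_nat (N choose m))
                    / (x * (P * (x - of_nat N)))"
      unfolding key .
    show ?thesis unfolding G bailey_kernel_def gbinomial_falling e3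
      using Q P x0 by (simp add: power_add)
  qed
  have "(\<Sum>m\<le>N. G m - G (Suc m)) = 0"
    by (subst sum_telescope) (simp add: G_def Suc)
  then show ?thesis
    by (simp only: term_eq sum_distrib_left[symmetric]) (simp add: Suc)
qed

text \<open>The Chu-Vandermonde summation that drives the chain. The factor \<open>D gchoose j\<close> cancels the
  first \<open>j\<close> factors of the falling factorial in the kernel. What remains, with \<open>j = r + m\<close>, is
  \<open>alternating_sum_inverse_falling\<close> at \<open>y = D - m\<close>.\<close>

lemma bailey_kernel_step:
  fixes D :: "'a::field_char_0"
  assumes D: "D \<notin> \<int>" and "m \<le> N"
  shows "(\<Sum>j=m..N. of_nat (N choose j) * (D gchoose j) * bailey_kernel D j m)
       = (D gchoose m) * bailey_kernel D N m"
proof -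
  define M where "M = N - m"
  have N: "N = M + m" using assms by (simp add: M_def)
  define y where "y = D - of_nat m"
  have y: "y \<notin> \<int>"
    unfolding y_def using D by (metis Ints_add Ints_of_nat diff_add_cancel)
  have Q: "falling D k \<noteq> 0" for k by (rule falling_nonzero[OF D])
  have "(\<Sum>j=m..N. of_nat (N choose j) * (D gchoose j) * bailey_kernel D j m)
      = (\<Sum>r\<le>M. of_nat (N choose (r + m)) * (D gchoose (r + m)) * bailey_kernel D (r + m) m)"
    using sum.shift_bounds_cl_nat_ivl[of _ 0 m M] by (simp add: N atLeast0AtMost)
  also have "\<dots> = (\<Sum>r\<le>M. fact m * of_nat (N choose m) *
        ((-1) ^ r * of_nat (M choose r) / falling (y - of_nat r) (Suc m)))"
  proof (rule sum.cong[OF refl])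
    fix r assume "r \<in> {..M}"
    then have "(N choose (r + m)) * ((r + m) choose m) = (N choose m) * (M choose r)"
      using choose_mult[of m "r + m" N] by (simp add: N)
    then have c: "of_nat (N choose (r + m)) * of_nat ((r + m) choose m)
            = (of_nat (N choose m) * of_nat (M choose r) :: 'a)"
      by (metis of_nat_mult)
    have e: "falling D (Suc (r + m + m)) = falling D (r + m) * falling (y - of_nat r) (Suc m)"
      using falling_add[of D "r + m" "Suc m"] by (simp add: y_def algebra_simps)
    have s: "(-1) ^ (r + m + m) = ((-1) ^ r :: 'a)"
      by (simp add: power_add flip: power_mult_distrib)
    have "of_nat (N choose (r + m)) * (D gchoose (r + m)) * bailey_kernel D (r + m) m
        = (of_nat (N choose (r + m)) * of_nat ((r + m) choose m)) *
          (fact m * (-1) ^ r / falling (y - of_nat r) (Suc m))"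
      unfolding bailey_kernel_def gbinomial_falling e s using Q[of "r + m"] by simp
    then show "of_nat (N choose (r + m)) * (D gchoose (r + m)) * bailey_kernel D (r + m) m
        = fact m * of_nat (N choose m) *
        ((-1) ^ r * of_nat (M choose r) / falling (y - of_nat r) (Suc m))"
      unfolding c by (simp add: mult_ac)
  qed
  also have "\<dots> = fact m * of_nat (N choose m) *
      ((-1) ^ M * fact (M + m) / fact m / falling y (Suc (M + m)))"
    by (simp only: sum_distrib_left[symmetric] alternating_sum_inverse_falling[OF y])
  also have "\<dots> = (D gchoose m) * bailey_kernel D N m"
  proof -
    have e: "falling D (Suc (N + m)) = falling D m * falling y (Suc (M + m))"
      using falling_add[of D m "Suc N"] by (simp add: y_def N add_ac)
    have s: "(-1) ^ (N + m) = ((-1) ^ M :: 'a)"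
      by (simp add: N power_add flip: power_mult_distrib)
    show ?thesis unfolding bailey_kernel_def gbinomial_falling e s
      using Q[of m] by (simp add: N)
  qed
  finally show ?thesis .
qed

lemma bailey_chain:
  fixes D :: "'a::field_char_0"
  assumes D: "D \<notin> \<int>"
  shows "bailey_beta D i N
       = (\<Sum>m\<le>N. (D - 2 * of_nat m) * (D gchoose m) ^ Suc i * bailey_kernel D N m)"
proof (induction i arbitrary: N)
  case 0
  then show ?case using unit_bailey_pair[OF D, of N] by simp
next
  case (Suc i)
  let ?\<alpha> = "\<lambda>m. (D - 2 * of_nat m) * (D gchoose m) ^ Suc i"
  have "bailey_beta D (Suc i) N
      = (\<Sum>j\<le>N. \<Sum>m\<le>j. ?\<alpha> m * (of_nat (N choose j) * (D gchoose j) * bailey_kernel D j m))"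
    by (simp add: Suc.IH sum_distrib_left mult_ac)
  also have "\<dots> = (\<Sum>m\<le>N. \<Sum>j=m..N.
                     ?\<alpha> m * (of_nat (N choose j) * (D gchoose j) * bailey_kernel D j m))"
    unfolding sum.Sigma[OF finite_atMost ballI[OF finite_atMost]]
      sum.Sigma[OF finite_atMost ballI[OF finite_atLeastAtMost]]
    by (rule sum.reindex_bij_witness[of _ "\<lambda>(m, j). (j, m)" "\<lambda>(j, m). (m, j)"]) auto
  also have "\<dots> = (\<Sum>m\<le>N. ?\<alpha> m * ((D gchoose m) * bailey_kernel D N m))"
    by (intro sum.cong refl)
      (simp only: sum_distrib_left[symmetric] atMost_iff bailey_kernel_step[OF D])
  finally show ?case by (simp add: mult_ac)
qed

section \<open>Sums over chains\<close>

lemma sum_weak_chains_Suc: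
  fixes F :: "(nat \<Rightarrow> nat) \<Rightarrow> 'a::comm_monoid_add"
  shows "(\<Sum>j\<in>weak_chains (Suc k) d. F j)
       = (\<Sum>j\<in>weak_chains k d. \<Sum>x=j k..d. F (j(Suc k := x)))"
proof -
  have fin: "finite (weak_chains k d)"
    unfolding weak_chains_def by (rule finite_subset[OF Collect_restrict]) (auto intro: finite_PiE)
  have "(\<Sum>j\<in>weak_chains k d. \<Sum>x=j k..d. F (j(Suc k := x)))
      = (\<Sum>(j, x)\<in>(SIGMA j:weak_chains k d. {j k..d}). F (j(Suc k := x)))"
    by (rule sum.Sigma) (auto simp: fin)
  also have "\<dots> = (\<Sum>j\<in>weak_chains (Suc k) d. F j)"
  proof (rule sum.reindex_bij_witness[where
      i = "\<lambda>j. (restrict j {0..k}, j (Suc k))" and j = "\<lambda>(j, x). j(Suc k := x)"])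
    fix p assume "p \<in> (SIGMA j:weak_chains k d. {j k..d})"
    then obtain j x where p: "p = (j, x)" and j: "j \<in> weak_chains k d" and x: "j k \<le> x" "x \<le> d"
      by auto
    have ext: "restrict (j(Suc k := x)) {0..k} = j"
      using j by (auto simp: weak_chains_def PiE_def extensional_def fun_eq_iff)
    show "(\<lambda>j. (restrict j {0..k}, j (Suc k))) ((\<lambda>(j, x). j(Suc k := x)) p) = p"
      using ext by (simp add: p)
    show "(\<lambda>(j, x). j(Suc k := x)) p \<in> weak_chains (Suc k) d"
      using j x by (auto simp: p weak_chains_def PiE_iff extensional_def le_Suc_eq)
  next
    fix j assume j: "j \<in> weak_chains (Suc k) d"
    show "(\<lambda>(j, x). j(Suc k := x)) (restrict j {0..k}, j (Suc k)) = j"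
      using j by (auto simp: weak_chains_def PiE_iff extensional_def fun_eq_iff)
    have "j k \<le> j (Suc k)" using j by (force simp: weak_chains_def)
    then show "(restrict j {0..k}, j (Suc k)) \<in> (SIGMA j:weak_chains k d. {j k..d})"
      using j by (auto simp: weak_chains_def PiE_iff)
  qed auto
  finally show ?thesis by simp
qed

lemma weak_chains_0: "weak_chains 0 d = {(\<lambda>i. undefined)(0 := 0)}"
  by (auto simp: weak_chains_def PiE_iff extensional_def fun_eq_iff)

text \<open>The free function \<open>f\<close> of the last entry makes the induction work. Chains grow at their last
  entry, and summing over it replaces \<open>f\<close> by another function of the entry before. Exchanging the
  two summations moves this operation from \<open>f\<close> to \<^const>\<open>bailey_beta\<close>, where it is one step of
  the recursion.\<close>

lemma sum_weak_chains_eq_bailey_beta: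
  fixes f :: "nat \<Rightarrow> real"
  shows "(\<Sum>j\<in>weak_chains k d.
            (\<Prod>i=1..k. real (d choose j i) / fact (j i - j (i - 1))) * f (j k))
       = (\<Sum>x\<le>d. f x * real (d choose x) / fact x * bailey_beta (real d) k x)"
proof (induction k arbitrary: f)
  case 0
  show ?case by (simp add: weak_chains_0 if_distrib cong: if_cong)
next
  case (Suc k)
  let ?w = "\<lambda>j. \<Prod>i=1..k. real (d choose j i) / fact (j i - j (i - 1))"
  let ?b = "bailey_beta (real d) k"
  have w: "(\<Prod>i=1..k. real (d choose (j(Suc k := x)) i)
              / fact ((j(Suc k := x)) i - (j(Suc k := x)) (i - 1))) = ?w j" for j :: "nat \<Rightarrow> nat" and x
    by (rule prod.cong) auto
  have "(\<Sum>j\<in>weak_chains (Suc k) d.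
            (\<Prod>i=1..Suc k. real (d choose j i) / fact (j i - j (i - 1))) * f (j (Suc k)))
      = (\<Sum>j\<in>weak_chains k d. ?w j * (\<Sum>x=j k..d. real (d choose x) / fact (x - j k) * f x))"
    by (simp only: sum_weak_chains_Suc prod.nat_ivl_Suc' le_add1 plus_1_eq_Suc w sum_distrib_left
          fun_upd_same diff_Suc_1 fun_upd_other[OF n_not_Suc_n])
       (simp add: mult_ac)
  also have "\<dots> = (\<Sum>y\<le>d. (\<Sum>x=y..d. real (d choose x) / fact (x - y) * f x)
                        * real (d choose y) / fact y * ?b y)"
    by (rule Suc.IH)
  also have "\<dots> = (\<Sum>y\<le>d. \<Sum>x=y..d. f x * real (d choose x) / fact x *
                        (real (x choose y) * real (d choose y) * ?b y))"
  proof (intro sum.cong refl)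
    fix y
    show "(\<Sum>x=y..d. real (d choose x) / fact (x - y) * f x) * real (d choose y) / fact y * ?b y
        = (\<Sum>x=y..d. f x * real (d choose x) / fact x *
                        (real (x choose y) * real (d choose y) * ?b y))"
      unfolding sum_distrib_right sum_divide_distrib
      by (intro sum.cong refl) (simp add: binomial_fact field_simps)
  qed
  also have "\<dots> = (\<Sum>x\<le>d. \<Sum>y\<le>x. f x * real (d choose x) / fact x *
                        (real (x choose y) * real (d choose y) * ?b y))"
    unfolding sum.Sigma[OF finite_atMost ballI[OF finite_atMost]]
      sum.Sigma[OF finite_atMost ballI[OF finite_atLeastAtMost]]
    by (rule sum.reindex_bij_witness[of _ "\<lambda>(x, y). (y, x)" "\<lambda>(y, x). (x, y)"]) auto
  finally show ?case
    by (simp add: sum_distrib_left binomial_gbinomial[symmetric])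
qed

section \<open>The limit at an integral upper index\<close>

lemma falling_has_log_derivative:
  fixes x :: real
  assumes "\<And>t. t < k \<Longrightarrow> x \<noteq> real t"
  shows "((\<lambda>y. falling y k) has_real_derivative falling x k * (\<Sum>t<k. 1 / (x - real t))) (at x)"
  using assms
proof (induction k)
  case (Suc k)
  have "x - real k \<noteq> 0" using Suc.prems[of k] by simp
  then show ?case
    unfolding falling_Suc using Suc
    by (auto intro!: derivative_eq_intros simp: field_simps)
qed simp

lemma sum_inverse_falling_of_nat:
  assumes "m \<le> d"
  shows "(\<Sum>t<m. 1 / (real d - real t)) = harm d - harm (d - m)"
  using assms
proof (induction m)
  case (Suc m)
  then have "d - m = Suc (d - Suc m)" by simp
  then have "harm (d - m) = harm (d - Suc m) + 1 / (real d - real m)"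
    using Suc.prems by (simp add: harm_Suc of_nat_diff field_simps)
  then show ?case using Suc by simp
qed simp

text \<open>The function \<open>g\<close> is \<open>D - d\<close> times the \<open>m\<close>-th term of \<open>bailey_chain\<close> for \<open>N = d\<close> and \<open>p = i + 1\<close>:
  the falling factorial of length \<open>d + m + 1\<close> in the kernel is split around its factor \<open>D - d\<close>,
  which is cancelled. The derivative is that of a product, each factor but \<open>D - 2 m\<close> being
  differentiated logarithmically.\<close>

lemma regularised_term_derivative:
  fixes d m p :: nat
  assumes "m \<le> d"
  defines "g \<equiv> \<lambda>D::real. (D - 2 * real m) * (D gchoose m) ^ p * ((-1) ^ (d + m) * fact d * fact m
                 * real (d choose m) / (falling D d * falling (D - real d - 1) m))"
  shows "(g has_real_derivative (-1) ^ d * real (d choose m) ^ Suc p *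
            (1 + (real d - 2 * real m) *
              (real p * (harm d - harm (d - m)) - harm d + harm m))) (at (real d))"
    and "g (real d) = (-1) ^ d * real (d choose m) ^ Suc p * (real d - 2 * real m)"
proof -
  let ?x = "real d"
  let ?C = "real (d choose m)"
  define c where "c = (-1) ^ (d + m) * fact d * fact m * ?C"
  define h where "h = (\<lambda>D. falling D d * falling (D - ?x - 1) m)"
  have g: "g = (\<lambda>D. (D - 2 * real m) * (D gchoose m) ^ p * (c / h D))"
    by (simp add: g_def c_def h_def)
  have hx: "h ?x = fact d * ((-1) ^ m * fact m)"
    using falling_of_nat_fact[of d d, where 'a = real] by (simp add: h_def falling_minus_one)
  have hx0: "h ?x \<noteq> 0" by (simp add: hx)
  have ch: "c / h ?x = (-1) ^ d * ?C"
    by (simp add: c_def hx power_add)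
  have Cx: "(?x gchoose m) = ?C" by (simp add: binomial_gbinomial)
  have dC: "((\<lambda>D. D gchoose m) has_real_derivative ?C * (harm d - harm (d - m))) (at ?x)"
  proof -
    have "((\<lambda>D. falling D m / fact m) has_real_derivative
            falling ?x m * (harm d - harm (d - m)) / fact m) (at ?x)"
      using falling_has_log_derivative[of m ?x] assms(1)
      by (intro DERIV_cdivide) (simp add: sum_inverse_falling_of_nat)
    then show ?thesis
      using assms(1) by (simp add: gbinomial_falling falling_of_nat_fact)
  qed
  have dCp: "((\<lambda>D. (D gchoose m) ^ p) has_real_derivative
               ?C ^ p * (real p * (harm d - harm (d - m)))) (at ?x)"
    using DERIV_power[OF dC, of p] by (cases p) (simp_all add: Cx mult_ac)
  have dB: "((\<lambda>D. falling D d) has_real_derivative falling ?x d * harm d) (at ?x)"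
    using falling_has_log_derivative[of d ?x] sum_inverse_falling_of_nat[of d d]
    by (simp add: harm_expand)
  have dE: "((\<lambda>D. falling (D - ?x - 1) m) has_real_derivative
               falling (?x - ?x - 1) m * (- harm m)) (at ?x)"
  proof -
    have "(\<Sum>t<m. 1 / (- 1 - real t)) = - harm m"
      by (induction m) (simp_all add: harm_Suc harm_expand field_simps)
    then have "((\<lambda>y. falling y m) has_real_derivative falling (?x - ?x - 1) m * (- harm m))
                 (at (?x - ?x - 1))"
      using falling_has_log_derivative[of m "- 1"] by simp
    moreover have "((\<lambda>D. D - ?x - 1) has_real_derivative 1) (at ?x)"
      by (auto intro!: derivative_eq_intros)
    ultimately show ?thesis
      using DERIV_chain2[of "\<lambda>y. falling y m"] by fastforce
  qed
  have dh: "(h has_real_derivative h ?x * (harm d - harm m)) (at ?x)"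
    unfolding h_def by (rule DERIV_cong[OF DERIV_mult[OF dB dE]]) (simp add: algebra_simps)
  have dch: "((\<lambda>D. c / h D) has_real_derivative (c / h ?x) * (harm m - harm d)) (at ?x)"
    by (rule DERIV_cong[OF DERIV_divide[OF DERIV_const dh hx0]])
      (use hx0 in \<open>simp add: field_simps\<close>)
  have dl: "((\<lambda>D. D - 2 * real m) has_real_derivative 1) (at ?x)"
    by (auto intro!: derivative_eq_intros)
  show "(g has_real_derivative (-1) ^ d * ?C ^ Suc p *
            (1 + (?x - 2 * real m) *
              (real p * (harm d - harm (d - m)) - harm d + harm m))) (at ?x)"
    unfolding g
    by (rule DERIV_cong[OF DERIV_mult[OF DERIV_mult[OF dl dCp] dch]])
      (simp only: ch Cx, simp add: algebra_simps)
  show "g ?x = (-1) ^ d * ?C ^ Suc p * (?x - 2 * real m)"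
    by (simp only: g ch Cx) (simp add: mult_ac)
qed

lemma continuous_bailey_beta:
  "continuous_on UNIV (\<lambda>D::real. bailey_beta D i N)"
proof (induction i arbitrary: N)
  case (Suc i)
  then show ?case
    unfolding bailey_beta.simps gbinomial_falling falling_def
    by (intro continuous_intros) auto
qed simp

lemma sum_antisymmetric_weight:
  fixes w :: "nat \<Rightarrow> real"
  assumes "\<And>m. m \<le> d \<Longrightarrow> w (d - m) = w m"
  shows "(\<Sum>m\<le>d. w m * (real d - 2 * real m) * u (d - m))
       = - (\<Sum>m\<le>d. w m * (real d - 2 * real m) * u m)"
proof -
  have "(\<Sum>m\<le>d. w m * (real d - 2 * real m) * u (d - m))
      = (\<Sum>m\<le>d. w (d - m) * (real d - 2 * real (d - m)) * u (d - (d - m)))"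
    by (rule sum.nat_diff_reindex[of _ "Suc d", unfolded lessThan_Suc_atMost, simplified, symmetric])
  also have "\<dots> = (\<Sum>m\<le>d. - (w m * (real d - 2 * real m) * u m))"
    using assms by (intro sum.cong) (auto simp: of_nat_diff algebra_simps)
  finally show ?thesis by (simp add: sum_negf)
qed

text \<open>Here the value at \<open>D = d\<close> is read off as the limit of the difference quotient of \<open>S\<close>, since the
  formula of \<open>bailey_chain\<close> itself degenerates there.\<close>

lemma bailey_beta_at_of_nat:
  "bailey_beta (real d) p d
   = (-1) ^ d / 2 * (\<Sum>m\<le>d. real (d choose m) ^ (p + 2) *
       (real (p + 2) * (real d - 2 * real m) * (harm m - harm (d - m)) + 2))"
proof -
  define q where "q = Suc p"
  define g where "g = (\<lambda>m (D::real). (D - 2 * real m) * (D gchoose m) ^ q *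
      ((-1) ^ (d + m) * fact d * fact m * real (d choose m)
        / (falling D d * falling (D - real d - 1) m)))"
  define S where "S = (\<lambda>D. \<Sum>m\<le>d. g m D)"
  let ?x = "real d"
  let ?w = "\<lambda>m. real (d choose m) ^ Suc q"
  let ?s = "\<lambda>u. \<Sum>m\<le>d. ?w m * (?x - 2 * real m) * u m"
  have sym: "?s (\<lambda>m. u (d - m)) = - ?s u" for u :: "nat \<Rightarrow> real"
    by (rule sum_antisymmetric_weight) (metis binomial_symmetric)
  have const: "?s (\<lambda>_. a) = 0" for a :: real
    using sym[of "\<lambda>_. a"] by simp
  have S: "(D - ?x) * bailey_beta D p d = S D" if "D \<notin> \<int>" for D
  proof -
    have "D \<noteq> ?x" using that by auto
    have "falling D (Suc (d + m)) = falling D d * ((D - ?x) * falling (D - ?x - 1) m)" for m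
      using falling_add[of D d "Suc m"] by (simp add: falling_Suc_left)
    then have "(D - ?x) * ((D - 2 * real m) * (D gchoose m) ^ Suc p * bailey_kernel D d m) = g m D" for m
      using \<open>D \<noteq> ?x\<close> by (simp add: g_def bailey_kernel_def q_def)
    then show ?thesis
      by (simp only: bailey_chain[OF that] S_def sum_distrib_left)
  qed
  have gx: "g m ?x = (-1) ^ d * ?w m * (?x - 2 * real m)" if "m \<le> d" for m
    using regularised_term_derivative(2)[OF that, of q] by (simp only: g_def)
  have Sx: "S ?x = 0"
  proof -
    have "S ?x = (-1) ^ d * ?s (\<lambda>_. 1)"
      unfolding S_def sum_distrib_left
      by (intro sum.cong refl) (simp add: gx)
    then show ?thesis by (simp only: const mult_zero_right)
  qed
  define S' where "S' = (\<Sum>m\<le>d. (-1) ^ d * ?w m * (1 + (?x - 2 * real m) *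
              (real q * (harm d - harm (d - m)) - harm d + harm m)))"
  have "(S has_real_derivative S') (at ?x)"
    unfolding S_def S'_def g_def by (intro DERIV_sum regularised_term_derivative(1)) simp
  then have "((\<lambda>D. (S D - S ?x) / (D - ?x)) \<longlongrightarrow> S') (at ?x)"
    by (simp add: has_field_derivative_iff)
  moreover have "((\<lambda>D. (S D - S ?x) / (D - ?x)) \<longlongrightarrow> bailey_beta ?x p d) (at ?x)"
  proof (rule Lim_transform_within)
    show "((\<lambda>D. bailey_beta D p d) \<longlongrightarrow> bailey_beta ?x p d) (at ?x)"
      using continuous_bailey_beta[of p d] by (simp add: continuous_on_def)
    show "bailey_beta D p d = (S D - S ?x) / (D - ?x)"
      if "0 < dist D ?x" "dist D ?x < 1" for D
    proof -
      have "D \<notin> \<int>"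
      proof
        assume "D \<in> \<int>"
        then obtain z where "D = of_int z" by (rule Ints_cases)
        then have "\<bar>z - int d\<bar> < 1" "z \<noteq> int d"
          using that by (auto simp: dist_real_def)
        then show False by linarith
      qed
      from S[OF this] show ?thesis using that by (simp add: Sx field_simps)
    qed
  qed auto
  ultimately have "bailey_beta ?x p d = S'"
    using tendsto_unique[of "at ?x"] by auto
  also have "S' = (-1) ^ d * ((\<Sum>m\<le>d. ?w m) + ?s (\<lambda>_. (real q - 1) * harm d)
                     - real q * ?s (\<lambda>m. harm (d - m)) + ?s harm)"
    unfolding S'_def sum_distrib_left sum.distrib[symmetric] sum_subtractf[symmetric]
    by (intro sum.cong refl) (simp add: algebra_simps)
  \<comment> \<open>The constant \<open>harm d\<close> drops out, and by antisymmetry the coefficients \<open>1\<close> of \<open>harm m\<close> and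
    \<open>- q\<close> of \<open>harm (d - m)\<close> may both be replaced by \<open>(q + 1) / 2\<close>, with opposite signs.\<close>
  also have "\<dots> = (-1) ^ d / 2 * (2 * (\<Sum>m\<le>d. ?w m)
                     + real (Suc q) * (?s harm - ?s (\<lambda>m. harm (d - m))))"
    unfolding const sym by (simp add: algebra_simps)
  also have "2 * (\<Sum>m\<le>d. ?w m) + real (Suc q) * (?s harm - ?s (\<lambda>m. harm (d - m)))
      = (\<Sum>m\<le>d. ?w m * (real (Suc q) * (?x - 2 * real m) * (harm m - harm (d - m)) + 2))"
    unfolding sum_distrib_left sum.distrib[symmetric] sum_subtractf[symmetric]
    by (intro sum.cong refl) (simp add: algebra_simps)
  finally show ?thesis by (simp add: q_def)
qed

theorem proposition3p5:
  fixes d n :: nat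
  assumes "n \<ge> 3"
  shows "(\<Sum>j\<in>weak_chains (n - 3) d.
            (fact d :: real) ^ (n - 2) /
              (fact (d - j (n - 3)) *
               (\<Prod>i=2..n - 2. fact (d - j (i - 1)) * fact (j (i - 1) - j (i - 2)) * fact (j (i - 1)))))
       = (-1) ^ d / 2 *
           (\<Sum>m=0..d. real (d choose m) ^ n *
              (real n * (real d - 2 * real m) * (harm m - harm (d - m)) + 2))"
proof -
  define k where "k = n - 3"
  have n: "n - 3 = k" "n - 2 = Suc k" "n = Suc k + 2" using assms by (simp_all add: k_def)
  let ?w = "\<lambda>j. \<Prod>i=1..k. real (d choose j i) / fact (j i - j (i - 1))"
  have "(fact d :: real) ^ Suc k / (fact (d - j k) *
           (\<Prod>i=2..Suc k. fact (d - j (i - 1)) * fact (j (i - 1) - j (i - 2)) * fact (j (i - 1))))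
      = ?w j * (fact d / fact (d - j k))" if "j \<in> weak_chains k d" for j
  proof -
    have "(\<Prod>i=2..Suc k. fact (d - j (i - 1)) * fact (j (i - 1) - j (i - 2)) * fact (j (i - 1)))
        = (\<Prod>i=1..k. fact (d - j i) * fact (j i - j (i - 1)) * (fact (j i) :: real))"
      using prod.shift_bounds_cl_Suc_ivl[of "\<lambda>i. fact (d - j (i - 1)) *
              fact (j (i - 1) - j (i - 2)) * (fact (j (i - 1)) :: real)" 1 k]
      by (simp add: numeral_2_eq_2)
    moreover have "?w j = (\<Prod>i=1..k. fact d / (fact (d - j i) * fact (j i - j (i - 1)) * fact (j i)))"
    proof (rule prod.cong[OF refl])
      fix i assume "i \<in> {1..k}"
      then have "j i \<le> d" using that by (auto simp: weak_chains_def PiE_iff)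
      then show "real (d choose j i) / fact (j i - j (i - 1))
               = fact d / (fact (d - j i) * fact (j i - j (i - 1)) * fact (j i))"
        by (simp add: binomial_fact mult_ac)
    qed
    ultimately show ?thesis by (simp add: prod_dividef mult_ac)
  qed
  then have "(\<Sum>j\<in>weak_chains k d. (fact d :: real) ^ Suc k / (fact (d - j k) *
           (\<Prod>i=2..Suc k. fact (d - j (i - 1)) * fact (j (i - 1) - j (i - 2)) * fact (j (i - 1)))))
      = (\<Sum>j\<in>weak_chains k d. ?w j * (fact d / fact (d - j k)))"
    by (rule sum.cong[OF refl])
  also have "\<dots> = (\<Sum>x\<le>d. fact d / fact (d - x) * real (d choose x) / fact x
                            * bailey_beta (real d) k x)"
    by (rule sum_weak_chains_eq_bailey_beta)
  \<comment> \<open>The weight \<open>d! / (d - x)!\<close> of the last entry, divided by \<open>x!\<close>, is \<open>d choose x\<close>: it supplies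
    one more step of the recursion.\<close>
  also have "\<dots> = bailey_beta (real d) (Suc k) d"
    unfolding bailey_beta.simps
    by (intro sum.cong refl) (simp add: binomial_fact binomial_gbinomial[symmetric] mult_ac)
  finally show ?thesis
    unfolding n(1,2) bailey_beta_at_of_nat by (simp only: n(3) atMost_atLeast0)
qed

end
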